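(* For all $\tau\in\mathbb{H}$, $$u^3(\tau)-u(3\tau)+2u^3(\tau)u(3\tau)+u^2(3\tau)+4u^3(\tau)u^2(3\tau)-u^3(3\tau)=0.$$
   Context: $\mathbb{H}$ is the complex upper half-plane, $q=e^{2\pi i\tau}$ and $q^r=e^{2\pi i r\tau}$ for rational $r$, $\eta(\tau)=q^{1/24}\prod_{n=1}^\infty(1-q^n)$ is the Dedekind eta function, and $$u(\tau):=\dfrac{\eta(3\tau)\eta^3(18\tau)}{\eta(6\tau)\eta^3(9\tau)}.$$ Here $u^k(\tau)$ denotes $u(\tau)^k$. *)

theory Defs
  imports "HOL-Analysis.Analysis"
begin

text \<open>
  The variable \<open>\<tau>\<close> is a plain complex number; the definitions below are only meaningful
  for \<open>Im \<tau> > 0\<close>, where the infinite product converges.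
\<close>

(* q^r, meaning exp (2 pi i r tau); this fixes the branch of the fractional powers of q *)
definition nome_power :: "rat \<Rightarrow> complex \<Rightarrow> complex" where
  "nome_power r \<tau> = exp (2 * of_real pi * \<i> * of_rat r * \<tau>)"

abbreviation nome :: "complex \<Rightarrow> complex" where
  "nome \<tau> \<equiv> nome_power 1 \<tau>"

(* prodinf starts at index 0, so the factor for n >= 1 appears at index n - 1 *)
definition dedekind_eta :: "complex \<Rightarrow> complex" where
  "dedekind_eta \<tau> = nome_power (1 / 24) \<tau> * prodinf (\<lambda>n. 1 - nome \<tau> ^ Suc n)"

definition u :: "complex \<Rightarrow> complex" where
  "u \<tau> = (dedekind_eta (3 * \<tau>) * dedekind_eta (18 * \<tau>) ^ 3) /
          (dedekind_eta (6 * \<tau>) * dedekind_eta (9 * \<tau>) ^ 3)"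

end

theory Submission
  imports Defs
begin

text \<open>
  Write \<open>q\<close> for the nome and \<open>P(q) = (1 - q)(1 - q\<^sup>2)(1 - q\<^sup>3)\<cdots>\<close>. The powers of
  \<open>q\<^bsup>1/24\<^esup>\<close> in the four eta functions combine to a single \<open>q\<close>, so \<open>u(\<tau>) = v(q)\<close> with
  \<open>v(q) = q P(q\<^sup>3) P(q\<^bsup>18\<^esup>)\<^sup>3 / (P(q\<^sup>6) P(q\<^sup>9)\<^sup>3)\<close>, which is Ramanujan's cubic continued
  fraction at \<open>q\<^sup>3\<close>, and \<open>u(3\<tau>) = v(q\<^sup>3)\<close>. The theorem is the cubic relation between \<open>v(q)\<close> and
  \<open>v(q\<^sup>3)\<close>, and it comes from two facts about \<open>\<psi>(q) = P(q\<^sup>2)\<^sup>2 / P(q) = \<Sum>n\<ge>0. q\<^bsup>n(n+1)/2\<^esup>\<close>.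

  First, splitting the series of \<open>\<psi>\<close> by the residue of the index modulo 3 gives
  \<open>\<psi>(q) = A(q\<^sup>3) + q \<psi>(q\<^sup>9)\<close>, where \<open>A\<close> is again a theta series with a product expansion.
  The quotient of the two parts is \<open>q \<psi>(q\<^sup>9) / A(q\<^sup>3) = v(q)\<close>, and therefore
  \<open>1 + 1/v(q) = \<psi>(q) / (q \<psi>(q\<^sup>9))\<close> (\<open>one_plus_cubic_cf\<close>, \<open>psi_cubic_cf\<close>).
  Both product expansions are instances of the Jacobi triple product (\<open>triple_product\<close>).

  Second, replacing \<open>q\<close> by \<open>\<omega>q\<close> with \<open>\<omega>\<close> a primitive cube root of unity multiplies \<open>v\<close> by \<open>\<omega>\<close>,
  and leaves \<open>A(q\<^sup>3)\<close> unchanged. Multiplying the first fact over the three cube roots turns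
  \<open>1 + v\<close> into \<open>1 + v\<^sup>3\<close> and yields
  \<open>1 + 1/v(q)\<^sup>3 = \<psi>(q\<^sup>3)\<^sup>4 / (q\<^sup>3 \<psi>(q\<^sup>9)\<^sup>4)\<close> (\<open>psi_cubic_cf_cubed\<close>).

  With \<open>w = v(q\<^sup>3)\<close>, the first fact at \<open>q\<^sup>3\<close> and the second at \<open>q\<close> and at \<open>q\<^sup>3\<close> let all values of
  \<open>\<psi>\<close> cancel: \<open>1 + 1/v\<^sup>3 = (1 + 1/w)\<^sup>4 / (1 + 1/w\<^sup>3)\<close>. This is the claim after a factor
  \<open>1 + w\<close> is removed (\<open>cubic_cf_cube\<close>).
\<close>

section \<open>Terms of the two-variable theta series\<close>

definition triangular :: "int \<Rightarrow> nat" where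
  "triangular k = nat (k * (k + 1) div 2)"

lemma two_triangular: "2 * int (triangular k) = k * (k + 1)"
proof -
  have "even (k * (k + 1))" "0 \<le> k * (k + 1)"
    by (auto simp: zero_le_mult_iff)
  thus ?thesis
    unfolding triangular_def by simp
qed

lemma triangular_eqI: "2 * int m = k * (k + 1) \<Longrightarrow> triangular k = m"
  using two_triangular[of k] by linarith

text \<open>
  The general term \<open>a\<^bsup>k(k+1)/2\<^esup> b\<^bsup>k(k-1)/2\<^esup>\<close> of Ramanujan's \<open>f(a, b)\<close>. Compared with
  \<open>q\<^bsup>k^2\<^esup> z\<^sup>k\<close>, this form has natural exponents only, also for negative \<open>k\<close>, so that no
  base has to be nonzero.
\<close>

definition theta_term :: "complex \<Rightarrow> complex \<Rightarrow> int \<Rightarrow> complex" where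
  "theta_term a b k = a ^ triangular k * b ^ triangular (- k)"

lemma theta_term_minus: "theta_term a b (- k) = theta_term b a k"
  by (simp add: theta_term_def)

text \<open>
  Consecutive terms have the ratio \<open>a (ab)\<^sup>k\<close>. The factor \<open>(ab)\<^sup>n\<close> on the left keeps the exponent
  on the right natural, and it is the one that occurs in the factors of the triple product.
\<close>

lemma theta_term_shift_up:
  assumes "k \<le> int n"
  shows "a * (a * b) ^ n * theta_term a b k = (a * b) ^ nat (int n - k) * theta_term a b (k + 1)"
proof -
  have "2 * int (1 + n + triangular k) = 2 * int (nat (int n - k) + triangular (k + 1))"
    using assms by (simp add: two_triangular distrib_left) (simp add: algebra_simps)
  hence a: "1 + n + triangular k = nat (int n - k) + triangular (k + 1)"
    by (simp only: mult_cancel_left of_nat_eq_iff) simp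
  have "2 * int (n + triangular (- k)) = 2 * int (nat (int n - k) + triangular (- (k + 1)))"
    using assms by (simp add: two_triangular distrib_left) (simp add: algebra_simps)
  hence b: "n + triangular (- k) = nat (int n - k) + triangular (- (k + 1))"
    by (simp only: mult_cancel_left of_nat_eq_iff) simp
  have "a * (a * b) ^ n * theta_term a b k = a ^ (1 + n + triangular k) * b ^ (n + triangular (- k))"
    by (simp add: theta_term_def power_mult_distrib power_add)
  also have "\<dots> = (a * b) ^ nat (int n - k) * theta_term a b (k + 1)"
    unfolding a b by (simp add: theta_term_def power_mult_distrib power_add)
  finally show ?thesis .
qed

lemma theta_term_shift_down:
  assumes "- k \<le> int n"
  shows "b * (a * b) ^ n * theta_term a b k = (a * b) ^ nat (int n + k) * theta_term a b (k - 1)"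
  using theta_term_shift_up[OF assms, of b a] theta_term_minus[of b a k] theta_term_minus[of b a "k - 1"]
  by (simp add: mult.commute[of b a] add.commute)

section \<open>The finite triple product\<close>

definition qpoch :: "complex \<Rightarrow> nat \<Rightarrow> complex" where
  "qpoch q n = (\<Prod>i<n. 1 - q ^ Suc i)"

lemma one_minus_power_nonzero:
  fixes q :: complex assumes "norm q < 1"
  shows "1 - q ^ Suc i \<noteq> 0"
proof
  assume "1 - q ^ Suc i = 0"
  hence "norm (q ^ Suc i) = 1" by simp
  moreover have "norm (q ^ Suc i) < 1"
    using power_less_one_iff[of "norm q" "Suc i"] assms by (simp only: norm_power norm_ge_zero) simp
  ultimately show False by simp
qed

lemma qpoch_nonzero: "norm q < 1 \<Longrightarrow> qpoch q n \<noteq> 0"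
  using one_minus_power_nonzero[of q] by (auto simp: qpoch_def)

text \<open>
  The value 0 at negative arguments is the usual convention for \<open>1 / (q; q)\<^sub>m\<close>. It makes the
  recurrence below hold at \<open>m = 0\<close> and cuts the finite theta sums off by themselves.
\<close>

definition inv_qpoch :: "complex \<Rightarrow> int \<Rightarrow> complex" where
  "inv_qpoch q m = (if m < 0 then 0 else inverse (qpoch q (nat m)))"

lemma inv_qpoch_pred:
  assumes "norm q < 1" "m \<ge> 0"
  shows "inv_qpoch q (m - 1) = (1 - q ^ nat m) * inv_qpoch q m"
proof (cases "m = 0")
  case False
  with assms obtain n where m: "m = int (Suc n)"
    by (metis nonneg_int_cases not0_implies_Suc of_nat_0)
  show ?thesis
    unfolding m using one_minus_power_nonzero[OF assms(1), of n] qpoch_nonzero[OF assms(1), of n]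
    by (simp add: inv_qpoch_def qpoch_def field_simps del: of_nat_Suc power_Suc)
       (auto simp: field_simps)
qed (auto simp: inv_qpoch_def)

text \<open>
  The coefficient form of the step from \<open>n\<close> to \<open>n + 1\<close> in the finite triple product. Put
  \<open>x = q\<^bsup>n+1-k\<^esup>\<close>, \<open>y = q\<^bsup>n+1+k\<^esup>\<close> and \<open>z = q\<^bsup>2n+1\<^esup>\<close>, so \<open>xy = qz\<close>. Dividing
  by the product of inverse q-Pochhammer symbols on the left leaves the polynomial identity
  \<open>(1 - z)(1 - xy) = (1 + z)(1 - x)(1 - y) + (x - z)(1 - y) + (y - z)(1 - x)\<close>.
\<close>

lemma inv_qpoch_pair_rec:
  assumes q: "norm q < 1" and k: "- int n - 1 \<le> k" "k \<le> int n + 1"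
  shows "(1 - q ^ (2 * n + 1)) * (1 - q ^ (2 * n + 2)) *
           (inv_qpoch q (int n + 1 - k) * inv_qpoch q (int n + 1 + k)) =
         (1 + q ^ (2 * n + 1)) * (inv_qpoch q (int n - k) * inv_qpoch q (int n + k)) +
         q ^ nat (int n + 1 - k) * (inv_qpoch q (int n - (k - 1)) * inv_qpoch q (int n + (k - 1))) +
         q ^ nat (int n + 1 + k) * (inv_qpoch q (int n - (k + 1)) * inv_qpoch q (int n + (k + 1)))"
    (is "?L = ?R")
proof -
  define i j where "i = nat (int n + 1 - k)" and "j = nat (int n + 1 + k)"
  have ij: "int i = int n + 1 - k" "int j = int n + 1 + k" "i + j = 2 * n + 2"
    using k by (auto simp: i_def j_def)
  define R where "R = inv_qpoch q"
  have R1: "R (int m - 1) = (1 - q ^ m) * R (int m)" for m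
    using inv_qpoch_pred[OF q, of "int m"] by (simp add: R_def)
  have e: "int n - k = int i - 1" "int n + k = int j - 1" "int n - (k - 1) = int i" 
      "int n + (k - 1) = int j - 2" "int n - (k + 1) = int i - 2" "int n + (k + 1) = int j"
    using ij by auto
  \<comment> \<open>The argument \<open>j - 2\<close> would need the negative power \<open>q\<^bsup>-1\<^esup>\<close>; the factor \<open>q ^ i\<close> absorbs it.\<close>
  have R3: "q ^ i * R (int j - 2) = (q ^ i - q ^ (2 * n + 1)) * R (int j - 1)" if "i + j = 2 * n + 2" for i j
  proof (cases j)
    case (Suc m)
    have h1: "q ^ i * q ^ m = q ^ (2 * n + 1)"
      using that Suc by (simp flip: power_add)
    have h2: "R (int j - 2) = (1 - q ^ m) * R (int j - 1)"
      using R1[of m] Suc by simp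
    show ?thesis
      unfolding h1[symmetric] h2 by (simp add: algebra_simps)
  next
    case 0
    thus ?thesis by (simp add: R_def inv_qpoch_def)
  qed
  have xy: "q ^ (2 * n + 2) = q ^ i * q ^ j"
    by (simp only: ij(3) flip: power_add)
  have "?R = (1 + q ^ (2 * n + 1)) * (R (int i - 1) * R (int j - 1)) + 
     R (int i) * (q ^ i * R (int j - 2)) + (q ^ j * R (int i - 2)) * R (int j)"
    unfolding e ij(1,2)[symmetric] nat_int R_def[symmetric] by (simp add: mult_ac)
  also have "\<dots> = (1 - q ^ (2 * n + 1)) * (1 - q ^ i * q ^ j) * (R (int i) * R (int j))"
    unfolding R3[OF ij(3)] R3[OF ij(3)[unfolded add.commute[of i j]]] R1 by (simp add: algebra_simps)
  also have "\<dots> = ?L"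
    unfolding xy ij(1,2)[symmetric] R_def[symmetric] ..
  finally show ?thesis ..
qed

text \<open>
  Up to the factor \<open>(ab; ab)\<^bsub>2n\<^esub>\<close>, the coefficients are the Gaussian binomial
  coefficients of \<open>2n\<close> over \<open>n + k\<close>.
\<close>

definition finite_theta :: "complex \<Rightarrow> complex \<Rightarrow> nat \<Rightarrow> complex" where
  "finite_theta a b n =
     (\<Sum>k = - int n..int n. inv_qpoch (a * b) (int n - k) * inv_qpoch (a * b) (int n + k) * theta_term a b k)"

text \<open>
  Expanding \<open>(1 + a q\<^sup>n)(1 + b q\<^sup>n) = 1 + q\<^bsup>2n+1\<^esup> + a q\<^sup>n + b q\<^sup>n\<close> with \<open>q = ab\<close>, the last
  two summands shift the terms of the series up and down by one. After reindexing, the coefficient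
  of each term is the right-hand side of \<open>inv_qpoch_pair_rec\<close>.
\<close>

lemma finite_theta_Suc:
  assumes ab: "norm (a * b) < 1"
  shows "(1 - (a * b) ^ (2 * n + 1)) * (1 - (a * b) ^ (2 * n + 2)) * finite_theta a b (Suc n) =
         (1 + a * (a * b) ^ n) * (1 + b * (a * b) ^ n) * finite_theta a b n"
proof -
  define q where "q = a * b"
  define R where "R = inv_qpoch q"
  define t where "t = theta_term a b"
  define c where "c k = R (int n - k) * R (int n + k)" for k
  define I where "I = {- int n - 1..int n + 1}"
  have fin: "finite I" by (simp add: I_def)
  have c0: "c k = 0" if "k > int n \<or> k < - int n" for k
    using that by (auto simp: c_def R_def inv_qpoch_def)
  have sub: "{- int n..int n} \<subseteq> I" by (auto simp: I_def)
  have up: "(\<Sum>k = - int n..int n. c k * (a * q ^ n * t k)) = (\<Sum>k\<in>I. q ^ nat (int n + 1 - k) * c (k - 1) * t k)"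
  proof -
    have "(\<Sum>k = - int n..int n. c k * (a * q ^ n * t k)) = (\<Sum>k = - int n..int n. q ^ nat (int n - k) * c k * t (k + 1))"
      by (intro sum.cong refl) (simp add: theta_term_shift_up t_def q_def)
    also have "\<dots> = (\<Sum>k = - int n + 1..int n + 1. q ^ nat (int n + 1 - k) * c (k - 1) * t k)"
      by (rule sum.reindex_bij_witness[of _ "\<lambda>k. k - 1" "\<lambda>k. k + 1"]) auto
    also have "\<dots> = (\<Sum>k\<in>I. q ^ nat (int n + 1 - k) * c (k - 1) * t k)"
      by (intro sum.mono_neutral_left fin) (auto simp: I_def intro!: c0)
    finally show ?thesis .
  qed
  have down: "(\<Sum>k = - int n..int n. c k * (b * q ^ n * t k)) = (\<Sum>k\<in>I. q ^ nat (int n + 1 + k) * c (k + 1) * t k)"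
  proof -
    have "(\<Sum>k = - int n..int n. c k * (b * q ^ n * t k)) = (\<Sum>k = - int n..int n. q ^ nat (int n + k) * c k * t (k - 1))"
      by (intro sum.cong refl) (simp add: theta_term_shift_down t_def q_def)
    also have "\<dots> = (\<Sum>k = - int n - 1..int n - 1. q ^ nat (int n + 1 + k) * c (k + 1) * t k)"
      by (rule sum.reindex_bij_witness[of _ "\<lambda>k. k + 1" "\<lambda>k. k - 1"]) (auto simp: algebra_simps)
    also have "\<dots> = (\<Sum>k\<in>I. q ^ nat (int n + 1 + k) * c (k + 1) * t k)"
      by (intro sum.mono_neutral_left fin) (auto simp: I_def intro!: c0)
    finally show ?thesis .
  qed
  have mid: "(\<Sum>k = - int n..int n. c k * t k) = (\<Sum>k\<in>I. c k * t k)"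
    by (intro sum.mono_neutral_left fin sub) (auto simp: I_def intro!: c0)
  have "(1 + a * q ^ n) * (1 + b * q ^ n) = 1 + q ^ (2 * n + 1) + a * q ^ n + b * q ^ n"
    by (simp add: q_def algebra_simps power_add power_mult power_mult_distrib power2_eq_square)
  hence "(1 + a * q ^ n) * (1 + b * q ^ n) * finite_theta a b n =
    (1 + q ^ (2 * n + 1)) * (\<Sum>k = - int n..int n. c k * t k)
    + (\<Sum>k = - int n..int n. c k * (a * q ^ n * t k)) + (\<Sum>k = - int n..int n. c k * (b * q ^ n * t k))"
    unfolding finite_theta_def q_def[symmetric] R_def[symmetric] c_def[symmetric] t_def[symmetric]
    by (simp only: sum_distrib_left flip: sum.distrib) (intro sum.cong, auto simp: algebra_simps)
  also have "\<dots> = (\<Sum>k\<in>I. ((1 + q ^ (2 * n + 1)) * c k + q ^ nat (int n + 1 - k) * c (k - 1)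
       + q ^ nat (int n + 1 + k) * c (k + 1)) * t k)"
    unfolding up down mid by (simp only: sum_distrib_left mult.assoc distrib_right flip: sum.distrib)
  also have "\<dots> = (\<Sum>k\<in>I. (1 - q ^ (2 * n + 1)) * (1 - q ^ (2 * n + 2)) *
           (R (int n + 1 - k) * R (int n + 1 + k)) * t k)"
  proof (intro sum.cong refl arg_cong2[where f = "(*)"])
    fix k assume "k \<in> I"
    thus "(1 + q ^ (2 * n + 1)) * c k + q ^ nat (int n + 1 - k) * c (k - 1) + q ^ nat (int n + 1 + k) * c (k + 1) = 
       (1 - q ^ (2 * n + 1)) * (1 - q ^ (2 * n + 2)) * (R (int n + 1 - k) * R (int n + 1 + k))"
      unfolding c_def R_def using inv_qpoch_pair_rec[of q n k] ab by (simp add: I_def q_def)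
  qed
  also have "\<dots> = (1 - q ^ (2 * n + 1)) * (1 - q ^ (2 * n + 2)) * finite_theta a b (Suc n)"
    unfolding finite_theta_def sum_distrib_left q_def[symmetric] R_def[symmetric] t_def[symmetric] I_def
    by (intro sum.cong) (auto simp: mult_ac add_ac)
  finally show ?thesis unfolding q_def ..
qed

lemma finite_triple_product:
  assumes ab: "norm (a * b) < 1"
  shows "qpoch (a * b) (2 * n) * finite_theta a b n =
         (\<Prod>i<n. 1 + a * (a * b) ^ i) * (\<Prod>i<n. 1 + b * (a * b) ^ i)"
proof (induction n)
  case 0
  have "triangular 0 = 0" by (rule triangular_eqI) simp
  thus ?case by (simp add: finite_theta_def qpoch_def inv_qpoch_def theta_term_def)
next
  case (Suc n)
  have "qpoch (a * b) (2 * Suc n) = qpoch (a * b) (2 * n) * ((1 - (a * b) ^ (2 * n + 1)) * (1 - (a * b) ^ (2 * n + 2)))"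
    by (simp add: qpoch_def)
  hence "qpoch (a * b) (2 * Suc n) * finite_theta a b (Suc n) =
      qpoch (a * b) (2 * n) *
        ((1 - (a * b) ^ (2 * n + 1)) * (1 - (a * b) ^ (2 * n + 2)) * finite_theta a b (Suc n))"
    by (simp only: mult.assoc)
  also have "\<dots> = (1 + a * (a * b) ^ n) * (1 + b * (a * b) ^ n) * (qpoch (a * b) (2 * n) * finite_theta a b n)"
    unfolding finite_theta_Suc[OF ab] by (simp only: mult_ac)
  finally show ?case
    unfolding Suc.IH by (simp add: mult_ac)
qed

section \<open>Limits of finite products\<close>

definition euler_prod :: "complex \<Rightarrow> complex" where
  "euler_prod q = prodinf (\<lambda>n. 1 - q ^ Suc n)"

lemma tendsto_prod_one_plus:
  fixes a q :: complex
  assumes "norm q < 1"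
  shows "(\<lambda>n. \<Prod>i<n. 1 + a * q ^ i) \<longlonglongrightarrow> prodinf (\<lambda>i. 1 + a * q ^ i)"
proof -
  have "summable (\<lambda>i. norm (a * q ^ i))"
    using assms by (simp add: norm_mult norm_power summable_mult)
  hence "convergent_prod (\<lambda>i. 1 + a * q ^ i)"
    by (intro abs_convergent_prod_imp_convergent_prod summable_imp_abs_convergent_prod) simp
  from convergent_prod_LIMSEQ[OF this] show ?thesis
    by (simp add: LIMSEQ_lessThan_iff_atMost)
qed

lemma tendsto_qpoch:
  assumes "norm q < 1"
  shows "qpoch q \<longlonglongrightarrow> euler_prod q"
  using tendsto_prod_one_plus[OF assms, of "- q"] by (simp add: qpoch_def[abs_def] euler_prod_def)

lemma euler_prod_nonzero:
  assumes "norm q < 1"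
  shows "euler_prod q \<noteq> 0"
proof -
  have "summable (\<lambda>i. norm (1 - q ^ Suc i - 1))"
    using assms by (simp add: norm_mult norm_power summable_mult)
  hence "convergent_prod (\<lambda>i. 1 - q ^ Suc i)"
    by (intro abs_convergent_prod_imp_convergent_prod summable_imp_abs_convergent_prod)
  thus ?thesis
    unfolding euler_prod_def by (rule prodinf_nonzero) (rule one_minus_power_nonzero[OF assms])
qed

lemma tendsto_inv_qpoch:
  assumes "norm q < 1" and f: "filterlim f at_top sequentially"
  shows "(\<lambda>n. inv_qpoch q (f n)) \<longlonglongrightarrow> inverse (euler_prod q)"
proof -
  have nat: "filterlim nat at_top (at_top :: int filter)"
    by (rule filterlim_at_top[THEN iffD2]) (metis eventually_at_top_linorder nat_le_iff nat_mono nat_int)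
  have "(\<lambda>n. inverse (qpoch q (nat (f n)))) \<longlonglongrightarrow> inverse (euler_prod q)"
    by (intro tendsto_inverse filterlim_compose[OF tendsto_qpoch] assms euler_prod_nonzero
          filterlim_compose[OF nat])
  moreover have "eventually (\<lambda>n. inverse (qpoch q (nat (f n))) = inv_qpoch q (f n)) sequentially"
    using f[unfolded filterlim_at_top, rule_format, of 0] by eventually_elim (simp add: inv_qpoch_def)
  ultimately show ?thesis
    by (rule Lim_transform_eventually)
qed

lemma bounded_inv_qpoch:
  assumes "norm q < 1"
  obtains M where "M > 0" "\<And>m. norm (inv_qpoch q m) \<le> M"
proof -
  have "(\<lambda>n. inverse (qpoch q n)) \<longlonglongrightarrow> inverse (euler_prod q)"
    by (intro tendsto_inverse tendsto_qpoch assms euler_prod_nonzero)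
  hence "Bseq (\<lambda>n. inverse (qpoch q n))"
    using convergentI convergent_imp_Bseq by blast
  then obtain M where "M > 0" "\<And>n. norm (inverse (qpoch q n)) \<le> M"
    by (auto simp: Bseq_def)
  thus ?thesis
    by (intro that[of M]) (auto simp: inv_qpoch_def)
qed

section \<open>The Jacobi triple product\<close>

lemma summable_theta_term_nat:
  assumes "norm (a * b) < 1"
  shows "summable (\<lambda>n. norm (theta_term a b (int n)))"
proof -
  have "(\<lambda>n. a * (a * b) ^ n) \<longlonglongrightarrow> a * 0"
    using assms by (intro tendsto_mult tendsto_const LIMSEQ_power_zero)
  from tendstoD[OF this, of "1 / 2"] have "eventually (\<lambda>n. norm (a * (a * b) ^ n) < 1 / 2) sequentially"
    by (simp add: dist_norm)
  then obtain N where N: "\<And>n. n \<ge> N \<Longrightarrow> norm (a * (a * b) ^ n) < 1 / 2"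
    by (auto simp: eventually_sequentially)
  show ?thesis
  proof (rule summable_ratio_test[of "1/2" N])
    fix n assume "n \<ge> N"
    have "norm (theta_term a b (int (Suc n))) = norm (a * (a * b) ^ n) * norm (theta_term a b (int n))"
      using theta_term_shift_up[of "int n" n a b] by (simp add: add.commute flip: norm_mult)
    also have "\<dots> \<le> 1 / 2 * norm (theta_term a b (int n))"
      using N[OF \<open>n \<ge> N\<close>] by (intro mult_right_mono) auto
    finally show "norm (norm (theta_term a b (int (Suc n)))) \<le> 1 / 2 * norm (norm (theta_term a b (int n)))"
      by simp
  qed simp
qed

lemma abs_summable_theta_term:
  assumes "norm (a * b) < 1"
  shows "(\<lambda>k. norm (theta_term a b k)) summable_on UNIV"
proof -
  have "(\<lambda>k. norm (theta_term a b k)) summable_on range int"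
    unfolding summable_on_reindex[OF inj_of_nat[where 'a = int]] o_def
    using summable_theta_term_nat[OF assms] by (intro norm_summable_imp_summable_on) simp
  moreover have "(\<lambda>k. norm (theta_term a b k)) summable_on range (\<lambda>n. - int n)"
    using summable_theta_term_nat[of b a] assms
    by (subst summable_on_reindex)
       (auto simp: inj_def o_def theta_term_minus mult.commute intro!: norm_summable_imp_summable_on)
  ultimately have "(\<lambda>k. norm (theta_term a b k)) summable_on (range int \<union> range (\<lambda>n. - int n))"
    by (rule summable_on_union)
  also have "range int \<union> range (\<lambda>n. - int n) = UNIV"
    by (auto simp: image_def) (metis int_cases2)
  finally show ?thesis .
qed

definition theta :: "complex \<Rightarrow> complex \<Rightarrow> complex" where
  "theta a b = (\<Sum>\<^sub>\<infinity>k. theta_term a b k)"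

lemma has_sum_theta:
  assumes "norm (a * b) < 1"
  shows "(theta_term a b has_sum theta a b) UNIV"
  unfolding theta_def using abs_summable_summable[OF abs_summable_theta_term[OF assms]] by simp

text \<open>
  Each coefficient tends to \<open>1 / (ab; ab)\<^sub>\<infinity>\<^sup>2\<close>, and the coefficients are bounded uniformly in
  \<open>n\<close> and \<open>k\<close>. So the absolutely convergent theta series dominates, and the limit may be taken
  under the sum.
\<close>

lemma finite_theta_tendsto:
  assumes ab: "norm (a * b) < 1"
  shows "finite_theta a b \<longlonglongrightarrow> inverse (euler_prod (a * b)) ^ 2 * theta a b"
proof -
  define q where "q = a * b"
  define R where "R = inv_qpoch q"
  define f where "f k n = R (int n - k) * R (int n + k) * theta_term a b k" for k n
  have q: "norm q < 1" using ab by (simp add: q_def)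
  obtain M where M: "M > 0" "\<And>m. norm (R m) \<le> M"
    using bounded_inv_qpoch[OF q] unfolding R_def by blast
  have bound: "norm (f k n) \<le> M * M * norm (theta_term a b k)" for k n
    unfolding f_def norm_mult using M by (intro mult_right_mono mult_mono) auto
  have unif: "uniform_limit UNIV (\<lambda>X n. \<Sum>k\<in>X. f k n) (\<lambda>n. \<Sum>\<^sub>\<infinity>k. f k n) (finite_subsets_at_top UNIV)"
    by (rule Weierstrass_m_test_general[where M = "\<lambda>k. M * M * norm (theta_term a b k)"])
       (use bound abs_summable_theta_term[OF ab] in \<open>auto intro: summable_on_cmult_right\<close>)
  have "(\<lambda>n. \<Sum>\<^sub>\<infinity>k. f k n) \<longlonglongrightarrow> inverse (euler_prod q) ^ 2 * theta a b"
  proof (rule swap_uniform_limit'[OF _ _ unif])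
    have up: "filterlim (\<lambda>n. int n + k) at_top sequentially" for k
    proof (rule filterlim_at_top[THEN iffD2], rule allI)
      fix Z :: int
      show "\<forall>\<^sub>F n in sequentially. Z \<le> int n + k"
        using eventually_ge_at_top[of "nat (Z - k)"] by eventually_elim linarith
    qed
    have minus: "filterlim (\<lambda>n. int n - k) at_top sequentially" for k
      using up[of "- k"] by simp
    have lim: "f k \<longlonglongrightarrow> inverse (euler_prod q) * inverse (euler_prod q) * theta_term a b k" for k
      unfolding f_def R_def
      by (intro tendsto_mult tendsto_const tendsto_inv_qpoch q minus up)
    show "\<forall>\<^sub>F X in finite_subsets_at_top UNIV.
        (\<lambda>n. \<Sum>k\<in>X. f k n) \<longlonglongrightarrow> (\<Sum>k\<in>X. inverse (euler_prod q) ^ 2 * theta_term a b k)"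
      using lim by (intro always_eventually allI tendsto_sum) (simp add: power2_eq_square)
    show "((\<lambda>X. \<Sum>k\<in>X. inverse (euler_prod q) ^ 2 * theta_term a b k)
        \<longlongrightarrow> inverse (euler_prod q) ^ 2 * theta a b) (finite_subsets_at_top UNIV)"
      using has_sum_cmult_right[OF has_sum_theta[OF ab]] by (simp add: has_sum_def)
  qed auto
  moreover have "(\<Sum>\<^sub>\<infinity>k. f k n) = finite_theta a b n" for n
  proof -
    have "(\<Sum>\<^sub>\<infinity>k. f k n) = (\<Sum>\<^sub>\<infinity>k\<in>{- int n..int n}. f k n)"
      by (rule infsum_cong_neutral) (auto simp: f_def R_def inv_qpoch_def)
    thus ?thesis
      by (simp add: finite_theta_def f_def R_def q_def)
  qed
  ultimately show ?thesis
    by (simp add: q_def)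
qed

theorem triple_product:
  assumes ab: "norm (a * b) < 1"
  shows "theta a b = euler_prod (a * b) *
           prodinf (\<lambda>i. 1 + a * (a * b) ^ i) * prodinf (\<lambda>i. 1 + b * (a * b) ^ i)"
proof -
  have "(\<lambda>n. qpoch (a * b) (2 * n) * finite_theta a b n) \<longlonglongrightarrow>
      euler_prod (a * b) * (inverse (euler_prod (a * b)) ^ 2 * theta a b)"
    by (intro tendsto_mult finite_theta_tendsto ab filterlim_compose[OF tendsto_qpoch]
          filterlim_subseq) (auto simp: strict_mono_def)
  moreover have "(\<lambda>n. (\<Prod>i<n. 1 + a * (a * b) ^ i) * (\<Prod>i<n. 1 + b * (a * b) ^ i)) \<longlonglongrightarrow>
      prodinf (\<lambda>i. 1 + a * (a * b) ^ i) * prodinf (\<lambda>i. 1 + b * (a * b) ^ i)"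
    by (intro tendsto_mult tendsto_prod_one_plus ab)
  ultimately have "euler_prod (a * b) * (inverse (euler_prod (a * b)) ^ 2 * theta a b) =
      prodinf (\<lambda>i. 1 + a * (a * b) ^ i) * prodinf (\<lambda>i. 1 + b * (a * b) ^ i)"
    unfolding finite_triple_product[OF ab] by (rule LIMSEQ_unique)
  thus ?thesis
    using euler_prod_nonzero[OF ab] by (simp add: power2_eq_square field_simps)
qed

text \<open>
  In the series of \<open>theta 1 q\<close> the exponent at \<open>k\<close> is \<open>k(k-1)/2\<close>. For \<open>k = 3m\<close> and for
  \<open>k = 3m + 1\<close> it is \<open>(9m\<^sup>2 \<mp> 3m)/2\<close>, and the two subseries agree by the symmetry
  \<open>m \<mapsto> -m\<close>. For \<open>k = 3m + 2\<close> it is \<open>1 + 9m(m+1)/2\<close>, which is a copy of the original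
  series in \<open>q\<^sup>9\<close>.
\<close>

lemma theta_dissection:
  assumes q: "norm q < 1"
  shows "theta 1 q = 2 * theta (q ^ 3) (q ^ 6) + q * theta 1 (q ^ 9)"
proof -
  let ?f = "\<lambda>r m. 3 * m + r :: int"
  have inj: "inj (?f r)" for r by (auto simp: inj_def)
  have e0: "theta_term 1 q (3 * m) = theta_term (q ^ 3) (q ^ 6) m" for m
  proof -
    have "triangular (- (3 * m)) = 3 * triangular m + 6 * triangular (- m)"
      by (rule triangular_eqI)
         (use two_triangular[of m] two_triangular[of "- m"] in \<open>simp add: algebra_simps\<close>)
    thus ?thesis by (simp add: theta_term_def power_add power_mult)
  qed
  have e1: "theta_term 1 q (3 * m + 1) = theta_term (q ^ 6) (q ^ 3) m" for m
  proof -
    have "triangular (- (3 * m + 1)) = 6 * triangular m + 3 * triangular (- m)"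
      by (rule triangular_eqI)
         (use two_triangular[of m] two_triangular[of "- m"] in \<open>simp add: algebra_simps\<close>)
    thus ?thesis by (simp add: theta_term_def power_add power_mult)
  qed
  have e2: "theta_term 1 q (3 * m + 2) = q * theta_term (q ^ 9) 1 m" for m
  proof -
    have "triangular (- (3 * m + 2)) = 1 + 9 * triangular m"
      by (rule triangular_eqI)
         (use two_triangular[of m] two_triangular[of "- m"] in \<open>simp add: algebra_simps\<close>)
    thus ?thesis by (simp add: theta_term_def power_add power_mult)
  qed
  have swap: "theta b a = theta a b" if "norm (a * b) < 1" for a b
  proof -
    have "bij (uminus :: int \<Rightarrow> int)"
      by (rule bij_uminus)
    from has_sum_reindex_bij_betw[OF this, of "theta_term a b" "theta a b"]
    have "(theta_term b a has_sum theta a b) UNIV"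
      using has_sum_theta[OF that] by (simp only: theta_term_minus)
    moreover have "(theta_term b a has_sum theta b a) UNIV"
      using that by (intro has_sum_theta) (simp only: mult.commute)
    ultimately show ?thesis
      by (rule has_sum_unique[symmetric])
  qed
  have n9: "norm (q ^ 9) < 1"
    using q by (simp add: norm_power power_less_one_iff)
  hence n36: "norm (q ^ 3 * q ^ 6) < 1" and n63: "norm (q ^ 6 * q ^ 3) < 1"
    by (simp_all flip: power_add)
  have h0: "(theta_term 1 q has_sum theta (q ^ 3) (q ^ 6)) (range (?f 0))"
    using has_sum_theta[OF n36] by (subst has_sum_reindex[OF inj]) (simp add: o_def e0)
  have h1: "(theta_term 1 q has_sum theta (q ^ 3) (q ^ 6)) (range (?f 1))"
    using has_sum_theta[OF n63] unfolding swap[OF n36]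
    by (subst has_sum_reindex[OF inj]) (simp only: o_def e1)
  have h2: "(theta_term 1 q has_sum (q * theta 1 (q ^ 9))) (range (?f 2))"
    using has_sum_cmult_right[OF has_sum_theta[of "q ^ 9" 1], of q] swap[of 1 "q ^ 9"] n9
    by (subst has_sum_reindex[OF inj]) (simp add: o_def e2)
  have d: "range (?f 0) \<inter> range (?f 1) = {}" "(range (?f 0) \<union> range (?f 1)) \<inter> range (?f 2) = {}"
    by (auto, presburger+)
  have U: "range (?f 0) \<union> range (?f 1) \<union> range (?f 2) = UNIV"
  proof -
    have "k = ?f 0 (k div 3) \<or> k = ?f 1 (k div 3) \<or> k = ?f 2 (k div 3)" for k by presburger
    thus ?thesis by blast
  qed
  have "(theta_term 1 q has_sum (theta (q ^ 3) (q ^ 6) + theta (q ^ 3) (q ^ 6) + q * theta 1 (q ^ 9))) UNIV"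
    using has_sum_Un_disjoint[OF has_sum_Un_disjoint[OF h0 h1 d(1)] h2 d(2)] unfolding U .
  moreover have "(theta_term 1 q has_sum theta 1 q) UNIV"
    using q by (intro has_sum_theta) simp
  ultimately have "theta 1 q = theta (q ^ 3) (q ^ 6) + theta (q ^ 3) (q ^ 6) + q * theta 1 (q ^ 9)"
    by (rule has_sum_unique[symmetric])
  thus ?thesis by simp
qed

section \<open>Infinite products and cube roots of unity\<close>

lemma norm_power_less_one:
  fixes q :: complex
  shows "norm q < 1 \<Longrightarrow> n > 0 \<Longrightarrow> norm (q ^ n) < 1"
  by (simp add: norm_power power_less_one_iff)

lemma qpoch_three_mult_Suc:
  "qpoch q (3 * Suc n) =
     qpoch q (3 * n) * ((1 - q * (q ^ n) ^ 3) * (1 - q ^ 2 * (q ^ n) ^ 3) * (1 - q ^ 3 * (q ^ n) ^ 3))"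
proof -
  have *: "(q ^ n) ^ 3 = q ^ (3 * n)"
    by (simp add: mult.commute flip: power_mult)
  have "3 * Suc n = Suc (Suc (Suc (3 * n)))"
    by simp
  hence "qpoch q (3 * Suc n) = qpoch q (Suc (Suc (Suc (3 * n))))"
    by (rule arg_cong)
  also have "\<dots> = qpoch q (3 * n) * ((1 - q * q ^ (3 * n)) * (1 - q ^ 2 * q ^ (3 * n)) * (1 - q ^ 3 * q ^ (3 * n)))"
    by (simp add: qpoch_def mult.assoc power2_eq_square power3_eq_cube)
  finally show ?thesis
    unfolding * .
qed

lemma tendsto_qpoch_mult:
  assumes "norm q < 1" "m > 0"
  shows "(\<lambda>n. qpoch q (m * n)) \<longlonglongrightarrow> euler_prod q"
  using filterlim_compose[OF tendsto_qpoch[OF assms(1)], of "\<lambda>n. m * n"] assms(2)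
  by (simp add: filterlim_subseq strict_mono_def)

lemma prodinf_one_plus_power:
  assumes q: "norm q < 1"
  shows "prodinf (\<lambda>i. 1 + q * q ^ i) * euler_prod q = euler_prod (q ^ 2)"
proof (rule LIMSEQ_unique)
  show "(\<lambda>n. (\<Prod>i<n. 1 + q * q ^ i) * qpoch q n) \<longlonglongrightarrow> prodinf (\<lambda>i. 1 + q * q ^ i) * euler_prod q"
    by (intro tendsto_mult tendsto_prod_one_plus tendsto_qpoch q)
  have "(\<Prod>i<n. 1 + q * q ^ i) * qpoch q n = qpoch (q ^ 2) n" for n
    unfolding qpoch_def prod.distrib[symmetric]
    by (intro prod.cong refl) (simp add: algebra_simps power2_eq_square power_mult_distrib)
  thus "(\<lambda>n. (\<Prod>i<n. 1 + q * q ^ i) * qpoch q n) \<longlonglongrightarrow> euler_prod (q ^ 2)"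
    using tendsto_qpoch[OF norm_power_less_one[OF q, of 2]] by simp
qed

text \<open>
  The triple product at \<open>(1, q)\<close> has the factors \<open>1 + q\<^sup>i\<close> and \<open>1 + q\<^bsup>i+1\<^esup>\<close>. They give the
  same infinite product up to the factor 2 at \<open>i = 0\<close>.
\<close>

lemma theta_1_q_product:
  assumes q: "norm q < 1"
  shows "theta 1 q * euler_prod q = 2 * euler_prod (q ^ 2) ^ 2"
proof -
  have "(\<lambda>n. \<Prod>i<Suc n. 1 + 1 * q ^ i) \<longlonglongrightarrow> prodinf (\<lambda>i. 1 + 1 * q ^ i)"
    using tendsto_prod_one_plus[OF q, of 1] by (rule LIMSEQ_Suc)
  moreover have "(\<Prod>i<Suc n. 1 + 1 * q ^ i) = 2 * (\<Prod>i<n. 1 + q * q ^ i)" for n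
    by (subst prod.lessThan_Suc_shift) simp
  ultimately have "(\<lambda>n. 2 * (\<Prod>i<n. 1 + q * q ^ i)) \<longlonglongrightarrow> prodinf (\<lambda>i. 1 + 1 * q ^ i)"
    by simp
  moreover have "(\<lambda>n. 2 * (\<Prod>i<n. 1 + q * q ^ i)) \<longlonglongrightarrow> 2 * prodinf (\<lambda>i. 1 + q * q ^ i)"
    by (intro tendsto_mult tendsto_const tendsto_prod_one_plus q)
  ultimately have "prodinf (\<lambda>i. 1 + 1 * q ^ i) = 2 * prodinf (\<lambda>i. 1 + q * q ^ i)"
    by (rule LIMSEQ_unique)
  hence "theta 1 q * euler_prod q =
      2 * (prodinf (\<lambda>i. 1 + q * q ^ i) * euler_prod q) * (prodinf (\<lambda>i. 1 + q * q ^ i) * euler_prod q)"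
    using triple_product[of 1 q] q by simp
  thus ?thesis
    unfolding prodinf_one_plus_power[OF q] by (simp add: power2_eq_square)
qed

text \<open>
  The triple product at \<open>(x, x\<^sup>2)\<close> runs over the factors \<open>1 + x\<^sup>k\<close> with \<open>k\<close> not divisible by 3,
  and these are the factors of \<open>P(x\<^sup>2)/P(x)\<close> without those of \<open>P(x\<^sup>6)/P(x\<^sup>3)\<close>. The
  comparison is made on partial products of length \<open>3m\<close> and \<open>m\<close>, which avoids rearranging an
  infinite product.
\<close>

lemma theta_x_x2_product:
  assumes x: "norm x < 1"
  shows "theta x (x ^ 2) * euler_prod x * euler_prod (x ^ 6) = euler_prod (x ^ 2) * euler_prod (x ^ 3) ^ 2"
proof -
  have x3: "x * x ^ 2 = x ^ 3" by (simp add: eval_nat_numeral)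
  define A B where "A a n = (\<Prod>i<n. 1 + a * (x ^ 3) ^ i)" and "B a = prodinf (\<lambda>i. 1 + a * (x ^ 3) ^ i)" for a n
  note n = norm_power_less_one[OF x]
  have fin: "A x m * A (x ^ 2) m * qpoch x (3 * m) * qpoch (x ^ 6) m = qpoch (x ^ 2) (3 * m) * qpoch (x ^ 3) m" for m
  proof (induction m)
    case (Suc m)
    define y where "y = (x ^ m) ^ 3"
    have y: "(x ^ 3) ^ m = y" "(x ^ 6) ^ m = y ^ 2" "((x ^ 2) ^ m) ^ 3 = y ^ 2"
      by (simp_all add: y_def mult.commute flip: power_mult)
    have step: "(1 + x * y) * (1 + x ^ 2 * y) * ((1 - x * y) * (1 - x ^ 2 * y) * (1 - x ^ 3 * y)) * (1 - x ^ 6 * y ^ 2)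
        = (1 - x ^ 2 * y ^ 2) * (1 - (x ^ 2) ^ 2 * y ^ 2) * (1 - (x ^ 2) ^ 3 * y ^ 2) * (1 - x ^ 3 * y)"
      by algebra
    have "A x (Suc m) * A (x ^ 2) (Suc m) * qpoch x (3 * Suc m) * qpoch (x ^ 6) (Suc m) =
       (A x m * A (x ^ 2) m * qpoch x (3 * m) * qpoch (x ^ 6) m) *
       ((1 + x * y) * (1 + x ^ 2 * y) * ((1 - x * y) * (1 - x ^ 2 * y) * (1 - x ^ 3 * y)) * (1 - x ^ 6 * y ^ 2))"
      unfolding qpoch_three_mult_Suc y_def[symmetric] by (simp add: A_def qpoch_def[of _ "Suc _"] y) (simp add: qpoch_def)
    also have "\<dots> = qpoch (x ^ 2) (3 * Suc m) * qpoch (x ^ 3) (Suc m)"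
      unfolding Suc.IH step qpoch_three_mult_Suc y by (simp add: qpoch_def[of _ "Suc _"] y) (simp add: qpoch_def)
    finally show ?case .
  qed (simp add: A_def qpoch_def)
  have "B x * B (x ^ 2) * euler_prod x * euler_prod (x ^ 6) = euler_prod (x ^ 2) * euler_prod (x ^ 3)"
  proof (rule LIMSEQ_unique)
    show "(\<lambda>m. A x m * A (x ^ 2) m * qpoch x (3 * m) * qpoch (x ^ 6) m) \<longlonglongrightarrow> 
        B x * B (x ^ 2) * euler_prod x * euler_prod (x ^ 6)"
      unfolding A_def B_def by (intro tendsto_mult tendsto_prod_one_plus tendsto_qpoch tendsto_qpoch_mult n x) auto
    show "(\<lambda>m. A x m * A (x ^ 2) m * qpoch x (3 * m) * qpoch (x ^ 6) m) \<longlonglongrightarrow> euler_prod (x ^ 2) * euler_prod (x ^ 3)"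
      unfolding fin by (intro tendsto_mult tendsto_qpoch tendsto_qpoch_mult n) auto
  qed
  moreover have "theta x (x ^ 2) = euler_prod (x ^ 3) * B x * B (x ^ 2)"
    using triple_product[of x "x ^ 2"] n[of 3] unfolding x3 B_def by simp
  ultimately show ?thesis
    by algebra
qed

lemma cube_root_of_unity:
  fixes w :: complex
  assumes "1 + w + w ^ 2 = 0"
  shows "w ^ 3 = 1" and "norm w = 1"
proof -
  show w3: "w ^ 3 = 1" using assms by algebra
  have "norm w ^ 3 = 1 ^ 3" using w3 by (simp flip: norm_power)
  thus "norm w = 1" by (rule power_eq_imp_eq_base) auto
qed

text \<open>
  The three factors with index \<open>n\<close> multiply to \<open>1 - q\<^bsup>3n\<^esup>\<close> if 3 does not divide \<open>n\<close>, and to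
  \<open>(1 - q\<^sup>n)\<^sup>3\<close> otherwise. So the product is \<open>P(q\<^sup>3)/P(q\<^sup>9)\<close> times \<open>P(q\<^sup>3)\<^sup>3\<close>.
\<close>

lemma euler_prod_cube_roots:
  assumes q: "norm q < 1" and w: "1 + w + w ^ 2 = 0"
  shows "euler_prod q * euler_prod (w * q) * euler_prod (w ^ 2 * q) * euler_prod (q ^ 9) = euler_prod (q ^ 3) ^ 4"
proof -
  note w3 = cube_root_of_unity(1)[OF w] and nw = cube_root_of_unity(2)[OF w]
  note n = norm_power_less_one[OF q]
  have nq: "norm (w * q) < 1" "norm (w ^ 2 * q) < 1"
    using q by (simp_all add: norm_mult norm_power nw)
  have fin: "qpoch q (3 * m) * qpoch (w * q) (3 * m) * qpoch (w ^ 2 * q) (3 * m) * qpoch (q ^ 9) m =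
     qpoch (q ^ 3) (3 * m) * qpoch (q ^ 3) m ^ 3" for m
  proof (induction m)
    case (Suc m)
    define y where "y = (q ^ m) ^ 3"
    have "(w ^ m) ^ 3 = 1" "((w ^ 2) ^ m) ^ 3 = 1"
      using w3 by (metis mult.commute power_mult power_one)+
    hence y: "(q ^ 3) ^ m = y" "(q ^ 9) ^ m = y ^ 3" "((w * q) ^ m) ^ 3 = y" "((w ^ 2 * q) ^ m) ^ 3 = y"
      by (simp_all add: y_def power_mult_distrib) (simp_all add: mult.commute flip: power_mult)
    have c: "(1 - z) * (1 - w * z) * (1 - w ^ 2 * z) = 1 - z ^ 3" for z
      using w by algebra
    have "((1 - q * y) * (1 - q ^ 2 * y) * (1 - q ^ 3 * y)) *
          ((1 - w * q * y) * (1 - (w * q) ^ 2 * y) * (1 - (w * q) ^ 3 * y)) *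
          ((1 - w ^ 2 * q * y) * (1 - (w ^ 2 * q) ^ 2 * y) * (1 - (w ^ 2 * q) ^ 3 * y)) =
          ((1 - q * y) * (1 - w * (q * y)) * (1 - w ^ 2 * (q * y))) *
          ((1 - q ^ 2 * y) * (1 - w * (q ^ 2 * y)) * (1 - w ^ 2 * (q ^ 2 * y))) * (1 - q ^ 3 * y) ^ 3"
    proof -
      have w4: "(w ^ 2) ^ 2 = w" and w6: "(w ^ 2) ^ 3 = 1"
        using w3 by algebra+
      have "(w * q) ^ 2 = w ^ 2 * q ^ 2" "(w * q) ^ 3 = q ^ 3" "(w ^ 2 * q) ^ 2 = w * q ^ 2" "(w ^ 2 * q) ^ 3 = q ^ 3"
        by (simp_all only: power_mult_distrib w3 w4 w6 mult_1_left)
      thus ?thesis by (simp only: power3_eq_cube mult_ac)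
    qed
    also have "\<dots> = (1 - q ^ 3 * y ^ 3) * (1 - (q ^ 3) ^ 2 * y ^ 3) * (1 - q ^ 3 * y) ^ 3"
      unfolding c by (simp add: power_mult_distrib flip: power_mult)
    finally have step: "((1 - q * y) * (1 - q ^ 2 * y) * (1 - q ^ 3 * y)) *
          ((1 - w * q * y) * (1 - (w * q) ^ 2 * y) * (1 - (w * q) ^ 3 * y)) *
          ((1 - w ^ 2 * q * y) * (1 - (w ^ 2 * q) ^ 2 * y) * (1 - (w ^ 2 * q) ^ 3 * y)) =
          (1 - q ^ 3 * y ^ 3) * (1 - (q ^ 3) ^ 2 * y ^ 3) * (1 - q ^ 3 * y) ^ 3" .
    have S: "qpoch (q ^ 9) (Suc m) = qpoch (q ^ 9) m * (1 - q ^ 9 * y ^ 3)"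
            "qpoch (q ^ 3) (Suc m) = qpoch (q ^ 3) m * (1 - q ^ 3 * y)"
      by (simp_all add: qpoch_def y)
    have "qpoch q (3 * Suc m) * qpoch (w * q) (3 * Suc m) * qpoch (w ^ 2 * q) (3 * Suc m) * qpoch (q ^ 9) (Suc m) =
       (qpoch q (3 * m) * qpoch (w * q) (3 * m) * qpoch (w ^ 2 * q) (3 * m) * qpoch (q ^ 9) m) *
        (((1 - q * y) * (1 - q ^ 2 * y) * (1 - q ^ 3 * y)) *
          ((1 - w * q * y) * (1 - (w * q) ^ 2 * y) * (1 - (w * q) ^ 3 * y)) *
          ((1 - w ^ 2 * q * y) * (1 - (w ^ 2 * q) ^ 2 * y) * (1 - (w ^ 2 * q) ^ 3 * y))) * (1 - q ^ 9 * y ^ 3)"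
      unfolding qpoch_three_mult_Suc S y y_def[symmetric] by (simp only: mult_ac)
    also have "\<dots> = qpoch (q ^ 3) (3 * Suc m) * qpoch (q ^ 3) (Suc m) ^ 3"
      unfolding step Suc.IH unfolding qpoch_three_mult_Suc S y by (simp add: power_mult_distrib mult_ac flip: power_mult)
    finally show ?case .
  qed (simp add: qpoch_def)
  have "euler_prod q * euler_prod (w * q) * euler_prod (w ^ 2 * q) * euler_prod (q ^ 9) =
      euler_prod (q ^ 3) * euler_prod (q ^ 3) ^ 3"
  proof (rule LIMSEQ_unique)
    show "(\<lambda>m. qpoch q (3 * m) * qpoch (w * q) (3 * m) * qpoch (w ^ 2 * q) (3 * m) * qpoch (q ^ 9) m) \<longlonglongrightarrow>
        euler_prod q * euler_prod (w * q) * euler_prod (w ^ 2 * q) * euler_prod (q ^ 9)"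
      by (intro tendsto_mult tendsto_qpoch tendsto_qpoch_mult n q nq) auto
    show "(\<lambda>m. qpoch q (3 * m) * qpoch (w * q) (3 * m) * qpoch (w ^ 2 * q) (3 * m) * qpoch (q ^ 9) m) \<longlonglongrightarrow>
        euler_prod (q ^ 3) * euler_prod (q ^ 3) ^ 3"
      unfolding fin by (intro tendsto_mult tendsto_power tendsto_qpoch tendsto_qpoch_mult n) auto
  qed
  thus ?thesis by (simp add: eval_nat_numeral)
qed

section \<open>The cubic continued fraction\<close>

definition ramanujan_psi :: "complex \<Rightarrow> complex" where
  "ramanujan_psi q = euler_prod (q ^ 2) ^ 2 / euler_prod q"

text \<open>
  Ramanujan's cubic continued fraction \<open>x\<^bsup>1/3\<^esup> / (1 + (x + x\<^sup>2) / (1 + (x\<^sup>2 + x\<^sup>4) / (1 + \<cdots>)))\<close>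
  at \<open>x = q\<^sup>3\<close>, in its product form. With this argument there is no fractional power.
\<close>

definition cubic_cf :: "complex \<Rightarrow> complex" where
  "cubic_cf q = q * (euler_prod (q ^ 3) * euler_prod (q ^ 18) ^ 3) / (euler_prod (q ^ 6) * euler_prod (q ^ 9) ^ 3)"

text \<open>
  The 3-dissection of \<open>\<psi>\<close>, divided by its part \<open>A(q\<^sup>3) = P(q\<^sup>6) P(q\<^sup>9)\<^sup>2 / (P(q\<^sup>3) P(q\<^bsup>18\<^esup>))\<close>.
\<close>

lemma one_plus_cubic_cf:
  assumes q: "norm q < 1"
  shows "1 + cubic_cf q = ramanujan_psi q *
           (euler_prod (q ^ 3) * euler_prod (q ^ 18) / (euler_prod (q ^ 6) * euler_prod (q ^ 9) ^ 2))"
proof -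
  note n = norm_power_less_one[OF q]
  have nz: "euler_prod (q ^ m) \<noteq> 0" if "m > 0" for m
    using euler_prod_nonzero n that by blast
  have nz1: "euler_prod q \<noteq> 0" using euler_prod_nonzero q .
  have psi: "theta 1 q = 2 * ramanujan_psi q"
    using theta_1_q_product[OF q] nz1 by (simp add: ramanujan_psi_def field_simps)
  have psi9: "theta 1 (q ^ 9) = 2 * euler_prod (q ^ 18) ^ 2 / euler_prod (q ^ 9)"
    using theta_1_q_product[OF n, of 9] nz[of 9] by (simp add: field_simps flip: power_mult)
  have A: "theta (q ^ 3) (q ^ 6) = euler_prod (q ^ 6) * euler_prod (q ^ 9) ^ 2 / (euler_prod (q ^ 3) * euler_prod (q ^ 18))"
    using theta_x_x2_product[OF n, of 3] nz[of 3] nz[of 18] by (simp add: field_simps flip: power_mult)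
  have "2 * ramanujan_psi q = 2 * (euler_prod (q ^ 6) * euler_prod (q ^ 9) ^ 2 / (euler_prod (q ^ 3) * euler_prod (q ^ 18))
      + q * (euler_prod (q ^ 18) ^ 2 / euler_prod (q ^ 9)))"
    using theta_dissection[OF q] unfolding psi psi9 A by (simp add: distrib_left)
  hence e: "ramanujan_psi q = euler_prod (q ^ 6) * euler_prod (q ^ 9) ^ 2 / (euler_prod (q ^ 3) * euler_prod (q ^ 18))
      + q * (euler_prod (q ^ 18) ^ 2 / euler_prod (q ^ 9))"
    by (simp only: mult_cancel_left) simp
  show ?thesis
    unfolding e cubic_cf_def using nz[of 3] nz[of 6] nz[of 9] nz[of 18]
    by (simp add: field_simps power2_eq_square power3_eq_cube)
qed

lemma psi_cubic_cf:
  assumes q: "norm q < 1"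
  shows "ramanujan_psi q * cubic_cf q = q * ramanujan_psi (q ^ 9) * (1 + cubic_cf q)"
proof -
  note n = norm_power_less_one[OF q]
  have nz: "euler_prod (q ^ m) \<noteq> 0" if "m > 0" for m
    using euler_prod_nonzero n that by blast
  have "ramanujan_psi (q ^ 9) = euler_prod (q ^ 18) ^ 2 / euler_prod (q ^ 9)"
    by (simp add: ramanujan_psi_def flip: power_mult)
  thus ?thesis
    unfolding one_plus_cubic_cf[OF q] using nz[of 3] nz[of 6] nz[of 9] nz[of 18]
    by (simp add: cubic_cf_def field_simps power2_eq_square power3_eq_cube)
qed

text \<open>
  The factor next to \<open>\<psi>(q)\<close> in \<open>one_plus_cubic_cf\<close> depends on \<open>q\<^sup>3\<close> only. So the product of that
  lemma over \<open>q\<close>, \<open>\<omega>q\<close>, \<open>\<omega>\<^sup>2q\<close> needs only the product of \<open>\<psi>\<close> over the three points, which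
  \<open>euler_prod_cube_roots\<close> evaluates.
\<close>

lemma psi_cubic_cf_cubed:
  assumes q: "norm q < 1"
  shows "(1 + cubic_cf q ^ 3) * (q ^ 3 * ramanujan_psi (q ^ 9) ^ 4) = cubic_cf q ^ 3 * ramanujan_psi (q ^ 3) ^ 4"
proof -
  define w where "w = Complex (- 1 / 2) (sqrt 3 / 2)"
  have w: "1 + w + w ^ 2 = 0"
    by (simp add: w_def complex_eq_iff power2_eq_square)
  note w3 = cube_root_of_unity(1)[OF w] and nw = cube_root_of_unity(2)[OF w]
  note n = norm_power_less_one[OF q]
  have nq: "norm (w * q) < 1" "norm (w ^ 2 * q) < 1"
    using q by (simp_all add: norm_mult norm_power nw)
  have nz: "euler_prod (q ^ m) \<noteq> 0" if "m > 0" for m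
    using euler_prod_nonzero n that by blast
  have w6: "(w ^ 2) ^ 3 = 1" using w3 by algebra
  have wp: "(w * q) ^ (3 * m) = q ^ (3 * m)" "(w ^ 2 * q) ^ (3 * m) = q ^ (3 * m)" for m
    by (simp_all only: power_mult_distrib power_mult w3 w6 power_one mult_1_left)
  have wps: "(w * q) ^ 3 = q ^ 3" "(w * q) ^ 6 = q ^ 6" "(w * q) ^ 9 = q ^ 9" "(w * q) ^ 18 = q ^ 18"
      "(w ^ 2 * q) ^ 3 = q ^ 3" "(w ^ 2 * q) ^ 6 = q ^ 6" "(w ^ 2 * q) ^ 9 = q ^ 9" "(w ^ 2 * q) ^ 18 = q ^ 18"
    using wp[of 1] wp[of 2] wp[of 3] wp[of 6] by simp_all
  have cw: "cubic_cf (w * q) = w * cubic_cf q" "cubic_cf (w ^ 2 * q) = w ^ 2 * cubic_cf q"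
    using wps by (simp_all add: cubic_cf_def)
  define K where "K = euler_prod (q ^ 3) * euler_prod (q ^ 18) / (euler_prod (q ^ 6) * euler_prod (q ^ 9) ^ 2)"
  have c: "(1 + z) * (1 + w * z) * (1 + w ^ 2 * z) = 1 + z ^ 3" for z
    using w by algebra
  have "1 + cubic_cf q ^ 3 = (1 + cubic_cf q) * (1 + cubic_cf (w * q)) * (1 + cubic_cf (w ^ 2 * q))"
    unfolding cw c ..
  also have "\<dots> = ramanujan_psi q * ramanujan_psi (w * q) * ramanujan_psi (w ^ 2 * q) * K ^ 3"
    unfolding one_plus_cubic_cf[OF q] one_plus_cubic_cf[OF nq(1)] one_plus_cubic_cf[OF nq(2)]
      wps K_def[symmetric] by (simp only: power3_eq_cube mult_ac)
  also have "ramanujan_psi q * ramanujan_psi (w * q) * ramanujan_psi (w ^ 2 * q) =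
      (euler_prod (q ^ 6) ^ 4 / euler_prod (q ^ 18)) ^ 2 / (euler_prod (q ^ 3) ^ 4 / euler_prod (q ^ 9))"
  proof -
    have 1: "euler_prod q * euler_prod (w * q) * euler_prod (w ^ 2 * q) = euler_prod (q ^ 3) ^ 4 / euler_prod (q ^ 9)"
      using euler_prod_cube_roots[OF q w] nz[of 9] by (simp add: field_simps)
    have w2: "(w ^ 2) ^ 2 = w" using w3 by algebra
    have 2: "euler_prod (q ^ 2) * euler_prod ((w * q) ^ 2) * euler_prod ((w ^ 2 * q) ^ 2) = euler_prod (q ^ 6) ^ 4 / euler_prod (q ^ 18)"
    proof -
      have e: "(w * q) ^ 2 = w ^ 2 * q ^ 2" "(w ^ 2 * q) ^ 2 = w * q ^ 2"
        by (simp_all only: power_mult_distrib w2)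
      have "euler_prod (q ^ 2) * euler_prod (w * q ^ 2) * euler_prod (w ^ 2 * q ^ 2) * euler_prod (q ^ 18) =
          euler_prod (q ^ 6) ^ 4"
        using euler_prod_cube_roots[OF n w, of 2] by (simp flip: power_mult)
      thus ?thesis
        unfolding e using nz[of 18] by (simp add: eq_divide_eq mult_ac)
    qed
    show ?thesis
      unfolding ramanujan_psi_def 1[symmetric] 2[symmetric] by (simp add: power_mult_distrib)
  qed
  finally have main: "1 + cubic_cf q ^ 3 =
      (euler_prod (q ^ 6) ^ 4 / euler_prod (q ^ 18)) ^ 2 / (euler_prod (q ^ 3) ^ 4 / euler_prod (q ^ 9)) * K ^ 3" .
  have psi: "ramanujan_psi (q ^ 9) = euler_prod (q ^ 18) ^ 2 / euler_prod (q ^ 9)"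
            "ramanujan_psi (q ^ 3) = euler_prod (q ^ 6) ^ 2 / euler_prod (q ^ 3)"
    by (simp_all add: ramanujan_psi_def flip: power_mult)
  show ?thesis
    unfolding main psi unfolding K_def cubic_cf_def using nz[of 3] nz[of 6] nz[of 9] nz[of 18]
    by (simp add: power_divide power_mult_distrib field_simps flip: power_mult power_add)
       (intro disjI2, algebra)
qed

lemma ramanujan_psi_nonzero: "norm q < 1 \<Longrightarrow> ramanujan_psi q \<noteq> 0"
  by (simp add: ramanujan_psi_def euler_prod_nonzero norm_power_less_one)

lemma cubic_cf_nonzero: "norm q < 1 \<Longrightarrow> q \<noteq> 0 \<Longrightarrow> cubic_cf q \<noteq> 0"
  by (simp add: cubic_cf_def euler_prod_nonzero norm_power_less_one)

text \<open>
  Elimination of the values \<open>s\<close>, \<open>t\<close>, \<open>r\<close> of \<open>\<psi>\<close> at \<open>q\<^sup>3\<close>, \<open>q\<^sup>9\<close>, \<open>q\<^bsup>27\<^esup>\<close>: the fourth power of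
  the linear relation at \<open>q\<^sup>3\<close> replaces \<open>s\<close> by \<open>r\<close> in the cubic relation at \<open>q\<close>, and the cubic
  relation at \<open>q\<^sup>3\<close> then replaces \<open>r\<close> by \<open>t\<close>, which cancels.
\<close>

lemma cubic_cf_cube:
  assumes q: "norm q < 1" "q \<noteq> 0"
  defines "v \<equiv> cubic_cf q" and "w \<equiv> cubic_cf (q ^ 3)"
  shows "v ^ 3 * (1 + 2 * w + 4 * w ^ 2) = w * (1 - w + w ^ 2)"
proof -
  note n = norm_power_less_one[OF q(1)]
  define s t r where "s = ramanujan_psi (q ^ 3)" and "t = ramanujan_psi (q ^ 9)" and "r = ramanujan_psi (q ^ 27)"
  have nz: "s \<noteq> 0" "t \<noteq> 0" "w \<noteq> 0" "v \<noteq> 0"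
    using n q by (auto simp: s_def t_def v_def w_def ramanujan_psi_nonzero cubic_cf_nonzero)
  have 1: "(1 + v ^ 3) * (q ^ 3 * t ^ 4) = v ^ 3 * s ^ 4"
    using psi_cubic_cf_cubed[OF q(1)] by (simp add: v_def s_def t_def)
  have 2: "(1 + w ^ 3) * (q ^ 9 * r ^ 4) = w ^ 3 * t ^ 4"
    using psi_cubic_cf_cubed[OF n, of 3] by (simp add: w_def r_def t_def flip: power_mult)
  have 3: "s * w = q ^ 3 * r * (1 + w)"
    using psi_cubic_cf[OF n, of 3] by (simp add: w_def r_def s_def flip: power_mult)
  have w1: "1 + w \<noteq> 0"
    using 3 nz by auto
  have 4: "s ^ 4 * w ^ 4 = q ^ 12 * r ^ 4 * (1 + w) ^ 4"
    using arg_cong[OF 3, of "\<lambda>z. z ^ 4"] by (simp add: power_mult_distrib flip: power_mult)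
  have "(q ^ 3 * t ^ 4 * w ^ 3 * (1 + w)) * ((1 + v ^ 3) * w * (1 - w + w ^ 2)) =
      ((1 + v ^ 3) * (q ^ 3 * t ^ 4)) * w ^ 4 * (1 + w ^ 3)"
    by algebra
  also have "\<dots> = v ^ 3 * (s ^ 4 * w ^ 4) * (1 + w ^ 3)"
    unfolding 1 by simp
  also have "\<dots> = v ^ 3 * q ^ 3 * (1 + w) ^ 4 * ((1 + w ^ 3) * (q ^ 9 * r ^ 4))"
    unfolding 4 by algebra
  also have "\<dots> = (q ^ 3 * t ^ 4 * w ^ 3 * (1 + w)) * (v ^ 3 * (1 + w) ^ 3)"
    unfolding 2 by algebra
  \<comment> \<open>The equation left is \<open>w (1 - w + w\<^sup>2) = v\<^sup>3 ((1 + w)\<^sup>3 - w (1 - w + w\<^sup>2))\<close>, where the factor of \<open>v\<^sup>3\<close> is \<open>1 + 2w + 4w\<^sup>2\<close>.\<close>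
  finally have "(1 + v ^ 3) * w * (1 - w + w ^ 2) = v ^ 3 * (1 + w) ^ 3"
    using nz w1 q(2) by simp
  thus ?thesis by algebra
qed

section \<open>The eta quotient\<close>

lemma nome_of_nat_mult: "nome (of_nat n * \<tau>) = nome \<tau> ^ n"
  by (simp add: nome_power_def exp_of_nat_mult[symmetric] mult_ac)

lemma dedekind_eta_of_nat_mult:
  "dedekind_eta (of_nat n * \<tau>) = exp (2 * of_real pi * \<i> * \<tau> / 24) ^ n * euler_prod (nome \<tau> ^ n)"
  by (simp add: dedekind_eta_def euler_prod_def nome_of_nat_mult nome_power_def exp_of_nat_mult[symmetric]
        of_rat_divide mult_ac)

lemma norm_nome: "Im \<tau> > 0 \<Longrightarrow> norm (nome \<tau>) < 1"
  by (simp add: nome_power_def)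

text \<open>
  In units of \<open>q\<^bsup>1/24\<^esup>\<close> the prefactors of the eta functions contribute the exponent
  \<open>3 + 3 \<cdot> 18 = 57\<close> above and \<open>6 + 3 \<cdot> 9 = 33\<close> below, and the difference is 24.
\<close>

lemma u_eq_cubic_cf: "u \<tau> = cubic_cf (nome \<tau>)"
proof -
  define e where "e = exp (2 * of_real pi * \<i> * \<tau> / 24)"
  have e0: "e \<noteq> 0" by (simp add: e_def)
  have e24: "e ^ 24 = nome \<tau>"
    by (simp add: e_def nome_power_def exp_of_nat_mult[symmetric] mult_ac)
  have "u \<tau> = e ^ 57 * (euler_prod (nome \<tau> ^ 3) * euler_prod (nome \<tau> ^ 18) ^ 3) /
        (e ^ 33 * (euler_prod (nome \<tau> ^ 6) * euler_prod (nome \<tau> ^ 9) ^ 3))"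
    using dedekind_eta_of_nat_mult[of 3 \<tau>] dedekind_eta_of_nat_mult[of 6 \<tau>] dedekind_eta_of_nat_mult[of 9 \<tau>] dedekind_eta_of_nat_mult[of 18 \<tau>]
    unfolding u_def e_def[symmetric]
    by (simp add: power_mult_distrib mult_ac flip: power_mult power_add)
  also have "e ^ 57 = e ^ 33 * nome \<tau>"
    unfolding e24[symmetric] by (simp flip: power_add)
  finally show ?thesis
    using e0 by (simp add: cubic_cf_def)
qed

theorem theorem4p5:
  fixes \<tau> :: complex
  assumes "Im \<tau> > 0"
  shows "u \<tau> ^ 3 - u (3 * \<tau>) + 2 * u \<tau> ^ 3 * u (3 * \<tau>) + u (3 * \<tau>) ^ 2
           + 4 * u \<tau> ^ 3 * u (3 * \<tau>) ^ 2 - u (3 * \<tau>) ^ 3 = 0"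
proof -
  have "nome (3 * \<tau>) = nome \<tau> ^ 3"
    using nome_of_nat_mult[of 3 \<tau>] by simp
  moreover have "nome \<tau> \<noteq> 0"
    by (simp add: nome_power_def)
  ultimately have "u \<tau> ^ 3 * (1 + 2 * u (3 * \<tau>) + 4 * u (3 * \<tau>) ^ 2) = u (3 * \<tau>) * (1 - u (3 * \<tau>) + u (3 * \<tau>) ^ 2)"
    using cubic_cf_cube[of "nome \<tau>"] norm_nome[OF assms] by (simp add: u_eq_cubic_cf)
  thus ?thesis by algebra
qed

end
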